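(* Let $G$ and $G'$ be two $n$-vertex graphs, let $f:V(G)\to V(G')$ be a bijection, and let $2^{f}:2^{V(G)}\to 2^{V(G')}$ be the isomorphism of $GF(2)$-vector spaces induced by $f$. Then the following three conditions are equivalent. 1. $f$ defines an isomorphism $M_A(G)\cong M_A(G')$. 2. $2^f$ maps the column space of $\mathcal{A}(G)$ onto the column space of $\mathcal{A}(G')$. 3. $2^f$ maps the nullspace of $\mathcal{A}(G)$ onto the nullspace of $\mathcal{A}(G')$. Also, the following three conditions are equivalent. 1$'$. $f$ defines an isomorphism $M_A(G)\cong M_A(G')^{*}$. 2$'$. $2^f$ maps the column space of $\mathcal{A}(G)$ onto the nullspace of $\mathcal{A}(G')$. 3$'$. $2^f$ maps the nullspace of $\mathcal{A}(G)$ onto the column space of $\mathcal{A}(G')$.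
   Context: Graphs are finite and may have loops and parallel edges. $\mathcal{A}(G)$ is the Boolean adjacency matrix of $G$: the symmetric $V(G)\times V(G)$ matrix over $GF(2)$ whose diagonal entry $a_{vv}$ is $1$ iff $v$ is looped, and whose off-diagonal entry $a_{vw}$ ($v\ne w$) is $1$ iff $v$ and $w$ are adjacent (multiplicities are ignored). The adjacency matroid $M_A(G)$ is the binary matroid on $V(G)$ represented by $\mathcal{A}(G)$: its circuits are the minimal nonempty subsets $S\subseteq V(G)$ such that the columns of $\mathcal{A}(G)$ corresponding to elements of $S$ are linearly dependent over $GF(2)$. $2^{V}$ is a $GF(2)$-vector space under symmetric difference, identified with $GF(2)^{V}$, so that the column space and the (right) nullspace of $\mathcal{A}(G)$ are subspaces of $2^{V(G)}$; $2^f(S)=f(S)$. $M^{*}$ denotes the dual matroid. A bijection of ground sets defines an isomorphism of matroids if the families of circuits correspond under it. *)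

theory Defs
  imports Complex_Main "HOL-Library.Z2" "HOL-Library.Function_Algebras"
begin

section \<open>Graphs with loops and parallel edges\<close>

text \<open>An edge \<open>e\<close> is a loop when \<open>ends G e\<close> is a singleton; edges are named, so
  distinct edges may have the same ends.\<close>

record ('v, 'e) multigraph =
  verts :: "'v set"
  edges :: "'e set"
  ends :: "'e \<Rightarrow> 'v set"

locale finite_multigraph =
  fixes G :: "('v, 'e) multigraph"
  assumes finite_verts: "finite (verts G)"
    and finite_edges: "finite (edges G)"
    and ends_subset: "e \<in> edges G \<Longrightarrow> ends G e \<subseteq> verts G"
    and card_ends: "e \<in> edges G \<Longrightarrow> card (ends G e) \<in> {1, 2}"

definition looped :: "('v, 'e) multigraph \<Rightarrow> 'v \<Rightarrow> bool" where
  "looped G v \<longleftrightarrow> (\<exists>e \<in> edges G. ends G e = {v})"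

definition adjacent :: "('v, 'e) multigraph \<Rightarrow> 'v \<Rightarrow> 'v \<Rightarrow> bool" where
  "adjacent G v w \<longleftrightarrow> v \<noteq> w \<and> (\<exists>e \<in> edges G. ends G e = {v, w})"

definition adjacency_matrix :: "('v, 'e) multigraph \<Rightarrow> 'v \<Rightarrow> 'v \<Rightarrow> bit" where
  "adjacency_matrix G v w = of_bool (if v = w then looped G v else adjacent G v w)"


section \<open>Linear algebra over the two-element field\<close>

text \<open>Vectors indexed by a set \<open>V\<close> are functions vanishing outside \<open>V\<close>. They correspond
  to subsets of \<open>V\<close> through their supports.\<close>

definition bit_scale :: "bit \<Rightarrow> ('v \<Rightarrow> bit) \<Rightarrow> 'v \<Rightarrow> bit" where
  "bit_scale c x = (\<lambda>v. c * x v)"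

interpretation gf2: vector_space "bit_scale :: bit \<Rightarrow> ('v \<Rightarrow> bit) \<Rightarrow> 'v \<Rightarrow> bit"
  by unfold_locales (auto simp: bit_scale_def fun_eq_iff algebra_simps)

definition support :: "('v \<Rightarrow> bit) \<Rightarrow> 'v set" where
  "support x = {v. x v \<noteq> 0}"

text \<open>A \<open>V\<close>-by-\<open>V\<close> matrix is a function of two arguments, of which only the values on
  \<open>V\<close> matter.\<close>

definition column :: "'v set \<Rightarrow> ('v \<Rightarrow> 'v \<Rightarrow> bit) \<Rightarrow> 'v \<Rightarrow> 'v \<Rightarrow> bit" where
  "column V A w = (\<lambda>v. if v \<in> V then A v w else 0)"

definition column_space :: "'v set \<Rightarrow> ('v \<Rightarrow> 'v \<Rightarrow> bit) \<Rightarrow> 'v set set" where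
  "column_space V A = support ` gf2.span (column V A ` V)"

definition nullspace :: "'v set \<Rightarrow> ('v \<Rightarrow> 'v \<Rightarrow> bit) \<Rightarrow> 'v set set" where
  "nullspace V A =
     support ` {x. support x \<subseteq> V \<and> (\<forall>v \<in> V. (\<Sum>w \<in> V. A v w * x w) = 0)}"

definition power_map :: "('v \<Rightarrow> 'w) \<Rightarrow> 'v set \<Rightarrow> 'w set" where
  "power_map f S = f ` S"


section \<open>Matroids\<close>

record 'a matroid_data =
  ground :: "'a set"
  indep :: "'a set \<Rightarrow> bool"

locale matroid =
  fixes M :: "'a matroid_data"
  assumes finite_ground: "finite (ground M)"
    and indep_subset_ground: "indep M X \<Longrightarrow> X \<subseteq> ground M"
    and indep_empty: "indep M {}"
    and indep_subset: "indep M X \<Longrightarrow> Y \<subseteq> X \<Longrightarrow> indep M Y"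
    and indep_augment: "indep M X \<Longrightarrow> indep M Y \<Longrightarrow> card X < card Y \<Longrightarrow>
      \<exists>y \<in> Y - X. indep M (insert y X)"

definition circuits :: "'a matroid_data \<Rightarrow> 'a set set" where
  "circuits M =
     {C. C \<subseteq> ground M \<and> \<not> indep M C \<and> (\<forall>D. D \<subset> C \<longrightarrow> indep M D)}"

definition bases :: "'a matroid_data \<Rightarrow> 'a set set" where
  "bases M =
     {B. B \<subseteq> ground M \<and> indep M B \<and> (\<forall>X. X \<subseteq> ground M \<and> B \<subset> X \<longrightarrow> \<not> indep M X)}"

text \<open>The bases of the dual are the complements of the bases.\<close>

definition dual_matroid :: "'a matroid_data \<Rightarrow> 'a matroid_data" where
  "dual_matroid M =
     \<lparr>ground = ground M, indep = (\<lambda>X. \<exists>B \<in> bases M. X \<subseteq> ground M - B)\<rparr>"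

definition matroid_isomorphism ::
    "('a \<Rightarrow> 'b) \<Rightarrow> 'a matroid_data \<Rightarrow> 'b matroid_data \<Rightarrow> bool" where
  "matroid_isomorphism f M N \<longleftrightarrow>
     bij_betw f (ground M) (ground N) \<and> (`) f ` circuits M = circuits N"

text \<open>The columns indexed by \<open>S\<close> form a family, so two equal columns are dependent;
  this is the reason for the injectivity condition.\<close>

definition column_matroid :: "'v set \<Rightarrow> ('v \<Rightarrow> 'v \<Rightarrow> bit) \<Rightarrow> 'v matroid_data" where
  "column_matroid V A =
     \<lparr>ground = V,
      indep = (\<lambda>S. S \<subseteq> V \<and> inj_on (column V A) S \<and> gf2.independent (column V A ` S))\<rparr>"

definition adjacency_matroid :: "('v, 'e) multigraph \<Rightarrow> 'v matroid_data" where
  "adjacency_matroid G = column_matroid (verts G) (adjacency_matrix G)"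

lemma matroid_column_matroid:
  assumes "finite V"
  shows "matroid (column_matroid V A)"
proof
  let ?c = "column V A"
  fix X Y
  assume X: "indep (column_matroid V A) X" and Y: "indep (column_matroid V A) Y"
    and less: "card X < card Y"
  from X Y have sub: "X \<subseteq> V" "Y \<subseteq> V" and inj: "inj_on ?c X" "inj_on ?c Y"
    and ind: "gf2.independent (?c ` X)" "gf2.independent (?c ` Y)"
    by (auto simp: column_matroid_def)
  have fin: "finite X" using sub(1) assms by (rule finite_subset)
  have "\<exists>y \<in> Y. ?c y \<notin> gf2.span (?c ` X)"
  proof (rule ccontr)
    assume "\<not> ?thesis"
    then have "?c ` Y \<subseteq> gf2.span (?c ` X)" by blast
    then have "card (?c ` Y) \<le> card (?c ` X)"
      using gf2.independent_span_bound[OF _ ind(2)] fin by blast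
    then show False using inj less by (simp add: card_image)
  qed
  then obtain y where y: "y \<in> Y" "?c y \<notin> gf2.span (?c ` X)" by blast
  then have out: "?c y \<notin> ?c ` X" using gf2.span_superset by blast
  have "gf2.independent (insert (?c y) (?c ` X))"
    using ind(1) y(2) by (simp add: gf2.independent_insert)
  then have "indep (column_matroid V A) (insert y X)"
    using sub y(1) inj(1) out by (auto simp: column_matroid_def)
  then show "\<exists>y \<in> Y - X. indep (column_matroid V A) (insert y X)"
    using y(1) out by blast
next
  fix X Y
  assume "indep (column_matroid V A) X" "Y \<subseteq> X"
  then show "indep (column_matroid V A) Y"
    using gf2.independent_mono[OF _ image_mono, of "column V A" X Y]
    by (auto simp: column_matroid_def intro: inj_on_subset)
qed (use assms in \<open>auto simp: column_matroid_def gf2.independent_empty\<close>)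

end

theory Submission
  imports Defs
begin

text \<open>A set of columns of \<open>A\<close> is dependent exactly when it includes a nonempty member of the
  nullspace \<open>N\<close> of \<open>A\<close>, so the circuits of the matroid are the minimal nonempty members of
  \<open>N\<close>. Every member of a subspace of a finite power set is a sum of minimal ones, hence the
  circuits determine \<open>N\<close>, and a bijection matches circuits iff it matches nullspaces
  (\<open>isomorphism_iff_cycle_space\<close>). Pass to the dual matroid: a set is
  dependent there iff it includes a nonempty member of \<open>N\<^sup>\<bottom>\<close>, the sets that meet every
  member of \<open>N\<close> evenly (\<open>cycle_space_dual\<close>). So the circuits of the dual determine
  \<open>N\<^sup>\<bottom>\<close> in the same way.

  The special feature of adjacency matrices is their symmetry. For any matrix, \<open>N\<close> is the
  orthogonal complement of the row space; here rows are columns, so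
  \<open>N = C\<^sup>\<bottom>\<close> with \<open>C\<close> the column space, and \<open>C = N\<^sup>\<bottom>\<close> because a subspace equals its
  double complement (\<open>orthogonal_orthogonal\<close>). Bijections of the ground set commute with
  complements, so matching two subspaces is the same as matching their complements. This
  exchanges nullspaces and column spaces and gives all the equivalences.

  Vectors over the two-element field are handled as sets throughout, with symmetric
  difference as addition and parity of the intersection as the bilinear form. Matrices enter
  only to identify the nullspace and the column space with such families of sets.\<close>

section \<open>Subspaces of a power set\<close>

definition power_subspace :: "'a set \<Rightarrow> 'a set set \<Rightarrow> bool" where
  "power_subspace V W \<longleftrightarrow> W \<subseteq> Pow V \<and> {} \<in> W \<and> (\<forall>X \<in> W. \<forall>Y \<in> W. sym_diff X Y \<in> W)"

definition orthogonal :: "'a set \<Rightarrow> 'a set set \<Rightarrow> 'a set set" where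
  "orthogonal V W = {T. T \<subseteq> V \<and> (\<forall>X \<in> W. even (card (X \<inter> T)))}"

definition minimal_members :: "'a set set \<Rightarrow> 'a set set" where
  "minimal_members W = {C \<in> W. C \<noteq> {} \<and> (\<forall>D \<in> W. D \<subset> C \<longrightarrow> D = {})}"

lemma sym_diff_cancel_left: "sym_diff X (sym_diff X Y) = Y"
  by blast

lemma even_card_sym_diff:
  assumes "finite X" "finite Y"
  shows "even (card (sym_diff X Y)) \<longleftrightarrow> (even (card X) \<longleftrightarrow> even (card Y))"
proof -
  have X: "card X = card (X - Y) + card (X \<inter> Y)"
    using assms by (metis card_Int_Diff add.commute)
  have Y: "card Y = card (Y - X) + card (X \<inter> Y)"
    using assms by (metis card_Int_Diff add.commute Int_commute)
  have "card (sym_diff X Y) = card (X - Y) + card (Y - X)"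
    using assms by (intro card_Un_disjoint) auto
  then show ?thesis using X Y by auto
qed

lemma even_card_sym_diff_Int:
  assumes "finite X" "finite Y"
  shows "even (card (sym_diff X Y \<inter> T)) \<longleftrightarrow>
    (even (card (X \<inter> T)) \<longleftrightarrow> even (card (Y \<inter> T)))"
proof -
  have "sym_diff X Y \<inter> T = sym_diff (X \<inter> T) (Y \<inter> T)" by blast
  then show ?thesis using even_card_sym_diff[of "X \<inter> T" "Y \<inter> T"] assms by simp
qed

lemma power_subspace_orthogonal:
  assumes "finite V"
  shows "power_subspace V (orthogonal V W)"
proof -
  have "sym_diff X Y \<in> orthogonal V W" if "X \<in> orthogonal V W" "Y \<in> orthogonal V W" for X Y
  proof -
    have "finite X" "finite Y"
      using that assms by (auto simp: orthogonal_def intro: finite_subset)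
    then show ?thesis
      using that even_card_sym_diff_Int[of X Y] unfolding orthogonal_def
      by (auto simp: Int_commute)
  qed
  then show ?thesis by (auto simp: power_subspace_def orthogonal_def)
qed

text \<open>A subspace that is maximal among those that contain \<open>W\<close> and avoid \<open>S\<close> has codimension
  one: if it contained neither \<open>X\<close> nor \<open>X + S\<close>, adjoining \<open>X\<close> would still avoid \<open>S\<close>. Such a
  hyperplane is the kernel of a linear functional, which is a parity functional: \<open>T\<close> collects
  the points whose singletons lie outside the hyperplane.\<close>

lemma separating_hyperplane:
  assumes fin: "finite V" and W: "power_subspace V W" and S: "S \<subseteq> V" "S \<notin> W"
  obtains T where "T \<in> orthogonal V W" "odd (card (S \<inter> T))"
proof -
  let ?P = "\<lambda>U. power_subspace V U \<and> W \<subseteq> U \<and> S \<notin> U"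
  have "finite {U. ?P U}"
    by (rule finite_subset[of _ "Pow (Pow V)"]) (use fin in \<open>auto simp: power_subspace_def\<close>)
  moreover have "W \<in> {U. ?P U}" using W S by simp
  ultimately obtain U where "U \<in> {U. ?P U}"
    and max': "\<forall>U' \<in> {U. ?P U}. U \<le> U' \<longrightarrow> U = U'"
    using finite_has_maximal[of "{U. ?P U}"] by (metis (no_types, lifting) empty_iff)
  then have U: "?P U" by blast
  have max: "U = U'" if "?P U'" "U \<subseteq> U'" for U'
    using max' that by blast
  have clos: "sym_diff X Y \<in> U" if "X \<in> U" "Y \<in> U" for X Y
    using U that by (auto simp: power_subspace_def)
  have sub: "X \<subseteq> V" if "X \<in> U" for X using U that by (auto simp: power_subspace_def)
  have cover: "X \<in> U \<or> sym_diff X S \<in> U" if X: "X \<subseteq> V" for X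
  proof (rule ccontr)
    assume neg: "\<not> ?thesis"
    let ?U = "U \<union> sym_diff X ` U"
    have "power_subspace V ?U"
      unfolding power_subspace_def
    proof (intro conjI ballI)
      show "?U \<subseteq> Pow V" using sub X by blast
      show "{} \<in> ?U" using U by (auto simp: power_subspace_def)
      fix Y Z assume Y: "Y \<in> ?U" and Z: "Z \<in> ?U"
      obtain A where A: "A \<in> U" "Y = A \<or> Y = sym_diff X A" using Y by blast
      obtain B where B: "B \<in> U" "Z = B \<or> Z = sym_diff X B" using Z by blast
      have "sym_diff Y Z = sym_diff A B \<or> sym_diff Y Z = sym_diff X (sym_diff A B)"
        using A(2) B(2) by (elim disjE) blast+
      then show "sym_diff Y Z \<in> ?U"
      proof
        assume e: "sym_diff Y Z = sym_diff A B"
        show ?thesis unfolding e using clos[OF A(1) B(1)] by (rule UnI1)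
      next
        assume e: "sym_diff Y Z = sym_diff X (sym_diff A B)"
        show ?thesis unfolding e using clos[OF A(1) B(1)] by (intro UnI2 imageI)
      qed
    qed
    moreover have "S \<notin> ?U"
    proof
      assume "S \<in> ?U"
      then obtain Y where "Y \<in> U" "S = sym_diff X Y" using U by blast
      then have "sym_diff X S = Y" by blast
      then show False using neg \<open>Y \<in> U\<close> by blast
    qed
    ultimately have "U = ?U" using U max[of ?U] by blast
    moreover have "X \<in> ?U" using U by (force simp: power_subspace_def)
    ultimately show False using neg by blast
  qed
  define T where "T = {v \<in> V. {v} \<notin> U}"
  have hyper: "X \<in> U \<longleftrightarrow> even (card (X \<inter> T))" if "finite X" "X \<subseteq> V" for X
    using that
  proof (induction X)
    case empty
    then show ?case using U by (simp add: power_subspace_def)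
  next
    case (insert v X)
    have v: "v \<in> V" "X \<subseteq> V" using insert.prems by auto
    have sd: "insert v X = sym_diff {v} X" using insert.hyps by blast
    show ?case
    proof (cases "{v} \<in> U")
      case True
      have "insert v X \<in> U \<longleftrightarrow> X \<in> U"
        using clos[OF True] sd sym_diff_cancel_left[of "{v}" X] by metis
      moreover have "insert v X \<inter> T = X \<inter> T" using True by (auto simp: T_def)
      ultimately show ?thesis using insert.IH v by simp
    next
      case False
      have vS: "sym_diff {v} S \<in> U" using cover[of "{v}"] False v by auto
      have "insert v X \<in> U \<longleftrightarrow> X \<notin> U"
      proof
        assume a: "insert v X \<in> U"
        show "X \<notin> U"
        proof
          assume "X \<in> U"
          from clos[OF a this] have "sym_diff (insert v X) X \<in> U" .
          moreover have "sym_diff (insert v X) X = {v}" using insert.hyps by blast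
          ultimately show False using False by simp
        qed
      next
        assume "X \<notin> U"
        then have "sym_diff X S \<in> U" using cover v by blast
        from clos[OF vS this] have "sym_diff (sym_diff {v} S) (sym_diff X S) \<in> U" .
        moreover have "sym_diff (sym_diff {v} S) (sym_diff X S) = sym_diff {v} X" by blast
        ultimately show "insert v X \<in> U" using sd by simp
      qed
      moreover have "insert v X \<inter> T = insert v (X \<inter> T)" using False v by (auto simp: T_def)
      ultimately show ?thesis using insert.IH insert.hyps v by simp
    qed
  qed
  have "T \<in> orthogonal V W"
    unfolding orthogonal_def
    using hyper U sub fin by (auto simp: T_def intro: finite_subset)
  moreover have "odd (card (S \<inter> T))" using hyper[of S] U S fin finite_subset by blast
  ultimately show thesis by (rule that)
qed

lemma orthogonal_orthogonal:
  assumes "finite V" "power_subspace V W"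
  shows "orthogonal V (orthogonal V W) = W"
proof
  show "W \<subseteq> orthogonal V (orthogonal V W)"
    using assms(2) by (auto simp: orthogonal_def power_subspace_def Int_commute)
  show "orthogonal V (orthogonal V W) \<subseteq> W"
  proof (rule subsetI, rule ccontr)
    fix S assume S: "S \<in> orthogonal V (orthogonal V W)" "S \<notin> W"
    then obtain T where "T \<in> orthogonal V W" "odd (card (S \<inter> T))"
      using separating_hyperplane[OF assms, of S] by (auto simp: orthogonal_def)
    then show False using S by (auto simp: orthogonal_def Int_commute)
  qed
qed

text \<open>A nonempty member \<open>X\<close> that is not minimal properly includes some nonempty member \<open>D\<close>, and
  is the sum of the smaller members \<open>D\<close> and \<open>X - D\<close>. So the minimal members span.\<close>

lemma minimal_members_generate:
  assumes fin: "finite V" and W: "power_subspace V W" and W': "power_subspace V' W'"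
    and "minimal_members W \<subseteq> W'"
  shows "W \<subseteq> W'"
proof
  fix X assume "X \<in> W"
  then have "finite X" using W fin by (auto simp: power_subspace_def intro: finite_subset)
  then show "X \<in> W'" using \<open>X \<in> W\<close>
  proof (induction X rule: finite_psubset_induct)
    case (psubset X)
    show ?case
    proof (cases "X = {} \<or> X \<in> minimal_members W")
      case True
      then show ?thesis using W' assms(4) by (auto simp: power_subspace_def)
    next
      case False
      then obtain D where D: "D \<in> W" "D \<subset> X" "D \<noteq> {}"
        using psubset.prems by (auto simp: minimal_members_def)
      have diff: "X - D = sym_diff X D" using D by blast
      then have "X - D \<in> W"
        using W D psubset.prems unfolding power_subspace_def by metis
      moreover have "X - D \<subset> X" using D by blast
      ultimately have "X - D \<in> W'" "D \<in> W'" using psubset.IH D by blast+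
      then have "sym_diff (X - D) D \<in> W'" using W' unfolding power_subspace_def by metis
      moreover have "sym_diff (X - D) D = X" using D by blast
      ultimately show ?thesis by simp
    qed
  qed
qed

section \<open>Transport along a bijection\<close>

lemma image_sym_diff:
  assumes "inj_on f V" "X \<subseteq> V" "Y \<subseteq> V"
  shows "f ` sym_diff X Y = sym_diff (f ` X) (f ` Y)"
proof -
  have "f ` (X - Y) = f ` X - f ` Y" "f ` (Y - X) = f ` Y - f ` X"
    using assms(2,3) by (intro inj_on_image_set_diff[OF assms(1)]; blast)+
  then show ?thesis by (simp only: image_Un)
qed

lemma power_subspace_image:
  assumes "bij_betw f V V'" "power_subspace V W"
  shows "power_subspace V' ((`) f ` W)"
  unfolding power_subspace_def
proof (intro conjI ballI)
  show "(`) f ` W \<subseteq> Pow V'" "{} \<in> (`) f ` W"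
    using assms by (auto simp: power_subspace_def bij_betw_def)
  fix X Y assume "X \<in> (`) f ` W" "Y \<in> (`) f ` W"
  then obtain A B where AB: "A \<in> W" "B \<in> W" "X = f ` A" "Y = f ` B" by blast
  then have "sym_diff X Y = f ` sym_diff A B"
    using assms image_sym_diff[of f V A B] by (auto simp: power_subspace_def bij_betw_def)
  then show "sym_diff X Y \<in> (`) f ` W" using AB assms by (auto simp: power_subspace_def)
qed

lemma orthogonal_image:
  assumes f: "bij_betw f V V'" and W: "W \<subseteq> Pow V"
  shows "orthogonal V' ((`) f ` W) = (`) f ` orthogonal V W"
proof -
  have inj: "inj_on f V" and img: "f ` V = V'" using f by (auto simp: bij_betw_def)
  have card: "card (f ` X \<inter> f ` T) = card (X \<inter> T)" if "X \<subseteq> V" "T \<subseteq> V" for X T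
  proof -
    have "f ` X \<inter> f ` T = f ` (X \<inter> T)" using inj_on_image_Int[OF inj] that by simp
    then show ?thesis using that inj by (metis card_image inj_on_subset le_infI1)
  qed
  show ?thesis
  proof (intro set_eqI iffI)
    fix S assume S: "S \<in> orthogonal V' ((`) f ` W)"
    then obtain T where T: "T \<subseteq> V" "S = f ` T"
      using img by (metis (mono_tags, lifting) mem_Collect_eq orthogonal_def subset_image_iff)
    have "even (card (X \<inter> T))" if "X \<in> W" for X
    proof -
      have "even (card (f ` X \<inter> f ` T))" using S T that by (simp add: orthogonal_def)
      then show ?thesis using card[of X T] W T(1) that by auto
    qed
    then have "T \<in> orthogonal V W" using T by (simp add: orthogonal_def)
    then show "S \<in> (`) f ` orthogonal V W" using T by blast
  next
    fix S assume "S \<in> (`) f ` orthogonal V W"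
    then obtain T where T: "T \<in> orthogonal V W" "S = f ` T" by blast
    then have TV: "T \<subseteq> V" by (simp add: orthogonal_def)
    have "even (card (f ` X \<inter> f ` T))" if "X \<in> W" for X
    proof -
      have "even (card (X \<inter> T))" using T that by (simp add: orthogonal_def)
      then show ?thesis using card[of X T] W TV that by auto
    qed
    then show "S \<in> orthogonal V' ((`) f ` W)"
      unfolding orthogonal_def T(2) using TV img by blast
  qed
qed

lemma minimal_members_image:
  assumes f: "inj_on f V" and W: "W \<subseteq> Pow V"
  shows "minimal_members ((`) f ` W) = (`) f ` minimal_members W"
proof -
  have strict: "f ` D \<subset> f ` C \<longleftrightarrow> D \<subset> C" if "C \<in> W" "D \<in> W" for C D
  proof -
    have sub: "C \<subseteq> V" "D \<subseteq> V" using W that by auto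
    have "f ` D \<subseteq> f ` C \<longleftrightarrow> D \<subseteq> C"
      using inj_on_image_mem_iff[OF f _ sub(1)] sub(2) unfolding image_subset_iff by blast
    then show ?thesis using inj_on_image_eq_iff[OF f sub(2,1)] by (simp add: psubset_eq)
  qed
  have "f ` C \<in> minimal_members ((`) f ` W) \<longleftrightarrow> C \<in> minimal_members W" if "C \<in> W" for C
    using that by (simp add: minimal_members_def strict)
  moreover have "minimal_members W \<subseteq> W" "minimal_members ((`) f ` W) \<subseteq> (`) f ` W"
    by (auto simp only: minimal_members_def)
  ultimately show ?thesis by blast
qed

text \<open>Minimal members are defined from the subspace and span it, so either determines the other.\<close>

lemma image_minimal_members_eq_iff:
  assumes fin: "finite V" and f: "bij_betw f V V'"
    and W: "power_subspace V W" and W': "power_subspace V' W'"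
  shows "(`) f ` minimal_members W = minimal_members W' \<longleftrightarrow> (`) f ` W = W'"
proof -
  have fin': "finite V'" using fin bij_betw_finite[OF f] by simp
  have img: "minimal_members ((`) f ` W) = (`) f ` minimal_members W"
    using W f by (intro minimal_members_image) (auto simp: power_subspace_def bij_betw_def)
  note fW = power_subspace_image[OF f W]
  have min: "minimal_members U \<subseteq> U" for U :: "'b set set" by (auto simp: minimal_members_def)
  show ?thesis
  proof
    assume eq: "(`) f ` minimal_members W = minimal_members W'"
    show "(`) f ` W = W'"
    proof
      show "(`) f ` W \<subseteq> W'"
        using minimal_members_generate[OF fin' fW W'] img eq min by metis
      show "W' \<subseteq> (`) f ` W"
        using minimal_members_generate[OF fin' W' fW] img eq min by metis
    qed
  next
    assume "(`) f ` W = W'"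
    then show "(`) f ` minimal_members W = minimal_members W'" by (simp only: img[symmetric])
  qed
qed

text \<open>Taking complements is injective on subspaces, since it is an involution there.\<close>

lemma image_orthogonal_eq_iff:
  assumes fin: "finite V" and f: "bij_betw f V V'"
    and W: "power_subspace V W" and W': "power_subspace V' W'"
  shows "(`) f ` orthogonal V W = orthogonal V' W' \<longleftrightarrow> (`) f ` W = W'"
proof -
  have fin': "finite V'" using fin bij_betw_finite[OF f] by simp
  have img: "orthogonal V' ((`) f ` W) = (`) f ` orthogonal V W"
    using W by (intro orthogonal_image[OF f]) (simp add: power_subspace_def)
  show ?thesis
  proof
    assume "(`) f ` orthogonal V W = orthogonal V' W'"
    then have "orthogonal V' (orthogonal V' ((`) f ` W)) = orthogonal V' (orthogonal V' W')"
      by (simp only: img)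
    then show "(`) f ` W = W'"
      by (simp only: orthogonal_orthogonal[OF fin'] W' power_subspace_image[OF f W])
  next
    assume "(`) f ` W = W'"
    then show "(`) f ` orthogonal V W = orthogonal V' W'" by (simp only: img[symmetric])
  qed
qed

section \<open>Matroids with a cycle space\<close>

text \<open>For a binary matroid \<open>W\<close> is the usual cycle space, the span of the circuits. The
  definition starts from the subspace instead: the independent sets are those that include no
  nonempty member of it.\<close>

definition cycle_space :: "'a matroid_data \<Rightarrow> 'a set set \<Rightarrow> bool" where
  "cycle_space M W \<longleftrightarrow> power_subspace (ground M) W \<and>
     (\<forall>S. indep M S \<longleftrightarrow> S \<subseteq> ground M \<and> (\<forall>T \<in> W. T \<subseteq> S \<longrightarrow> T = {}))"

lemma circuits_eq_minimal_members:
  assumes "cycle_space M W"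
  shows "circuits M = minimal_members W"
proof -
  have W: "\<And>X. X \<in> W \<Longrightarrow> X \<subseteq> ground M" "{} \<in> W"
    and ind: "\<And>S. indep M S \<longleftrightarrow> S \<subseteq> ground M \<and> (\<forall>T \<in> W. T \<subseteq> S \<longrightarrow> T = {})"
    using assms by (auto simp: cycle_space_def power_subspace_def)
  show ?thesis
  proof (intro set_eqI iffI)
    fix C assume "C \<in> circuits M"
    then have C: "C \<subseteq> ground M" "\<not> indep M C" and min: "\<And>D. D \<subset> C \<Longrightarrow> indep M D"
      by (auto simp: circuits_def)
    have indD: "D = {}" if "D \<in> W" "indep M D" for D using that unfolding ind by blast
    obtain T where T: "T \<in> W" "T \<subseteq> C" "T \<noteq> {}" using C unfolding ind by blast
    have "T = C" using T min[of T] indD[of T] by blast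
    then have "C \<in> W" "C \<noteq> {}" using T by simp_all
    moreover have "D = {}" if "D \<in> W" "D \<subset> C" for D using that by (intro indD min)
    ultimately show "C \<in> minimal_members W" by (simp add: minimal_members_def)
  next
    fix C assume C: "C \<in> minimal_members W"
    then have sub: "C \<subseteq> ground M" using W by (auto simp: minimal_members_def)
    have mem: "C \<in> W" "C \<noteq> {}" and min: "\<And>D. D \<in> W \<Longrightarrow> D \<subset> C \<Longrightarrow> D = {}"
      using C by (simp_all add: minimal_members_def)
    have "\<not> indep M C" using mem ind by blast
    moreover have "indep M D" if D: "D \<subset> C" for D
    proof -
      have "T = {}" if "T \<in> W" "T \<subseteq> D" for T
        using that D by (intro min) auto
      then show ?thesis using D sub unfolding ind by blast
    qed
    ultimately show "C \<in> circuits M" using sub by (simp add: circuits_def)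
  qed
qed

lemma isomorphism_iff_cycle_space:
  assumes "finite (ground M)" "bij_betw f (ground M) (ground N)"
    and "cycle_space M W" "cycle_space N W'"
  shows "matroid_isomorphism f M N \<longleftrightarrow> (`) f ` W = W'"
proof -
  have "power_subspace (ground M) W" "power_subspace (ground N) W'"
    using assms by (auto simp: cycle_space_def)
  from image_minimal_members_eq_iff[OF assms(1,2) this] show ?thesis
    using assms by (simp add: matroid_isomorphism_def circuits_eq_minimal_members)
qed

text \<open>A set \<open>D\<close> is independent in the dual iff some basis avoids it. If a nonempty
  \<open>T \<subseteq> D\<close> met every cycle evenly, adding a point of \<open>T\<close> to a basis that avoids \<open>D\<close> would
  create a cycle meeting \<open>T\<close> in that point alone. Conversely, the members of \<open>W\<^sup>\<bottom>\<close> inside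
  \<open>D\<close> form the complement of \<open>W + 2\<^bsup>V - D\<^esup>\<close>. If there is only the empty one, then
  \<open>W + 2\<^bsup>V - D\<^esup>\<close> is all of \<open>2\<^sup>V\<close>; this puts each point of \<open>D\<close> on a cycle whose other
  points avoid \<open>D\<close>, so that a maximal independent subset of \<open>V - D\<close> is already a basis.\<close>

lemma cycle_space_dual:
  assumes fin: "finite (ground M)" and W: "cycle_space M W"
  shows "cycle_space (dual_matroid M) (orthogonal (ground M) W)"
proof -
  let ?V = "ground M" and ?C = "orthogonal (ground M) W"
  have sp: "power_subspace ?V W" using W by (simp add: cycle_space_def)
  then have WV: "\<And>X. X \<in> W \<Longrightarrow> X \<subseteq> ?V"
    and clos: "\<And>X Y. X \<in> W \<Longrightarrow> Y \<in> W \<Longrightarrow> sym_diff X Y \<in> W"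
    by (auto simp: power_subspace_def)
  have ind: "\<And>S. indep M S \<longleftrightarrow> S \<subseteq> ground M \<and> (\<forall>T \<in> W. T \<subseteq> S \<longrightarrow> T = {})"
    using W by (simp add: cycle_space_def)
  have "(\<exists>B \<in> bases M. D \<subseteq> ?V - B) \<longleftrightarrow> D \<subseteq> ?V \<and> (\<forall>T \<in> ?C. T \<subseteq> D \<longrightarrow> T = {})" for D
  proof
    assume "\<exists>B \<in> bases M. D \<subseteq> ?V - B"
    then obtain B where B: "indep M B" "B \<subseteq> ?V" "D \<subseteq> ?V - B"
      and max: "\<And>X. X \<subseteq> ?V \<Longrightarrow> B \<subset> X \<Longrightarrow> \<not> indep M X" by (auto simp: bases_def)
    have False if T: "T \<in> ?C" "T \<subseteq> D" "t \<in> T" for T t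
    proof -
      have t: "t \<in> ?V" "t \<notin> B" using T B by auto
      then have "\<not> indep M (insert t B)" using max[of "insert t B"] B by blast
      then obtain Z where Z: "Z \<in> W" "Z \<subseteq> insert t B" "Z \<noteq> {}" using ind t B by auto
      then have "t \<in> Z" using B ind by blast
      then have "Z \<inter> T = {t}" using Z T B by blast
      then show False using T Z by (auto simp: orthogonal_def)
    qed
    then show "D \<subseteq> ?V \<and> (\<forall>T \<in> ?C. T \<subseteq> D \<longrightarrow> T = {})" using B by blast
  next
    assume D: "D \<subseteq> ?V \<and> (\<forall>T \<in> ?C. T \<subseteq> D \<longrightarrow> T = {})"
    \<comment> \<open>This is the subspace \<open>W + 2\<^bsup>V - D\<^esup>\<close>.\<close>
    let ?U = "{X. \<exists>Z \<in> W. \<exists>Y. Y \<subseteq> ?V - D \<and> X = sym_diff Z Y}"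
    have "power_subspace ?V ?U"
      unfolding power_subspace_def
    proof (intro conjI ballI)
      show "?U \<subseteq> Pow ?V" using WV by blast
      show "{} \<in> ?U" using sp by (auto simp: power_subspace_def)
      fix X1 X2 assume "X1 \<in> ?U" "X2 \<in> ?U"
      then obtain Z1 Y1 Z2 Y2 where *: "Z1 \<in> W" "Y1 \<subseteq> ?V - D" "X1 = sym_diff Z1 Y1"
         "Z2 \<in> W" "Y2 \<subseteq> ?V - D" "X2 = sym_diff Z2 Y2" by blast
      have "sym_diff (sym_diff Z1 Y1) (sym_diff Z2 Y2)
        = sym_diff (sym_diff Z1 Z2) (sym_diff Y1 Y2)" by blast
      moreover have "sym_diff Y1 Y2 \<subseteq> ?V - D" using * by blast
      moreover have "sym_diff Z1 Z2 \<in> W" using * clos by simp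
      ultimately have "\<exists>Z \<in> W. \<exists>Y. Y \<subseteq> ?V - D \<and> sym_diff X1 X2 = sym_diff Z Y"
        using *(3,6) by (metis (no_types, lifting))
      then show "sym_diff X1 X2 \<in> ?U" by (rule CollectI)
    qed
    then have UU: "orthogonal ?V (orthogonal ?V ?U) = ?U" by (rule orthogonal_orthogonal[OF fin])
    have trivial: "T = {}" if T: "T \<in> orthogonal ?V ?U" for T
    proof -
      have "W \<subseteq> ?U" by blast
      then have "T \<in> ?C" using T unfolding orthogonal_def by blast
      moreover have "T \<subseteq> D"
      proof (rule ccontr)
        assume "\<not> T \<subseteq> D"
        then obtain v where v: "v \<in> T" "v \<notin> D" by blast
        then have "{v} \<subseteq> ?V - D" "{} \<in> W"
          using T sp by (auto simp: orthogonal_def power_subspace_def)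
        then have "{v} \<in> ?U" by blast
        then have "even (card ({v} \<inter> T))" using T unfolding orthogonal_def by blast
        then show False using v by simp
      qed
      ultimately show ?thesis using D by blast
    qed
    have "\<And>X. X \<subseteq> ?V \<Longrightarrow> X \<in> orthogonal ?V (orthogonal ?V ?U)"
      unfolding orthogonal_def[of _ "orthogonal _ _"] by (auto dest!: trivial)
    then have full: "\<And>X. X \<subseteq> ?V \<Longrightarrow> X \<in> ?U" using UU by simp
    let ?I = "{B. B \<subseteq> ?V - D \<and> indep M B}"
    have "finite ?I" using fin by (auto intro: finite_subset[of _ "Pow ?V"])
    moreover have "{} \<in> ?I" by (auto simp: ind)
    ultimately obtain B where B: "B \<subseteq> ?V - D" "indep M B"
      and max: "\<And>B'. B' \<subseteq> ?V - D \<Longrightarrow> indep M B' \<Longrightarrow> B \<subseteq> B' \<Longrightarrow> B = B'"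
      using finite_has_maximal[of ?I] by (smt (verit) empty_iff mem_Collect_eq)
    \<comment> \<open>Fundamental cycles: the points outside \<open>D\<close> depend on \<open>B\<close> by the maximality of \<open>B\<close>.\<close>
    have fund: "\<exists>Z \<in> W. y \<in> Z \<and> Z \<subseteq> insert y B" if y: "y \<in> ?V - D - B" for y
    proof -
      have "\<not> indep M (insert y B)" using max[of "insert y B"] y B by blast
      then obtain Z where "Z \<in> W" "Z \<subseteq> insert y B" "Z \<noteq> {}" using ind y B by auto
      moreover from this have "y \<in> Z" using B ind by blast
      ultimately show ?thesis by blast
    qed
    have dep: "\<exists>Z \<in> W. x \<in> Z \<and> Z \<subseteq> insert x B" if x: "x \<in> ?V - B" for x
    proof (cases "x \<in> D")
      case False
      then show ?thesis using fund x by blast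
    next
      case True
      \<comment> \<open>Among the cycles through \<open>x\<close> whose other points avoid \<open>D\<close>, one with the fewest points
        outside \<open>B\<close> has only \<open>x\<close> there: any other could be removed by adding its fundamental
        cycle, which does not contain \<open>x\<close>.\<close>
      let ?Q = "\<lambda>Z. Z \<in> W \<and> x \<in> Z \<and> Z \<subseteq> insert x (?V - D)"
      have "{x} \<in> ?U" using x by (intro full) auto
      then obtain Z0 Y where ZY: "Z0 \<in> W" "Y \<subseteq> ?V - D" "{x} = sym_diff Z0 Y" by blast
      then have "?Q Z0" using True by blast
      from exists_least_iff[of "\<lambda>k. \<exists>Z. ?Q Z \<and> card (Z - B) = k"] this
      obtain Z where Z: "?Q Z" and least: "\<And>Z'. ?Q Z' \<Longrightarrow> \<not> card (Z' - B) < card (Z - B)"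
        by metis
      have "Z \<subseteq> insert x B"
      proof (rule ccontr)
        assume "\<not> ?thesis"
        then obtain y where y: "y \<in> Z" "y \<noteq> x" "y \<notin> B" by blast
        then obtain Z' where Z': "Z' \<in> W" "y \<in> Z'" "Z' \<subseteq> insert y B" using fund[of y] Z by blast
        have "x \<notin> Z'" using Z' y x by blast
        then have "?Q (sym_diff Z Z')" using Z Z' B y clos[of Z Z'] by blast
        moreover have "sym_diff Z Z' - B \<subset> Z - B" using Z Z' y by blast
        moreover have "finite (Z - B)" using Z WV fin finite_subset by blast
        ultimately show False using least psubset_card_mono by blast
      qed
      then show ?thesis using Z by blast
    qed
    have "B \<in> bases M"
      unfolding bases_def
    proof (intro CollectI conjI allI impI)
      fix X assume X: "X \<subseteq> ?V \<and> B \<subset> X"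
      then obtain x where "x \<in> X" "x \<in> ?V - B" by blast
      then show "\<not> indep M X" using dep[of x] X unfolding ind by blast
    qed (use B in auto)
    then show "\<exists>B \<in> bases M. D \<subseteq> ?V - B" using B D by blast
  qed
  then show ?thesis
    using power_subspace_orthogonal[OF fin, of W] by (simp add: cycle_space_def dual_matroid_def)
qed

section \<open>Column matroids over the two-element field\<close>

definition char_vec :: "'a set \<Rightarrow> 'a \<Rightarrow> bit" where
  "char_vec S = (\<lambda>v. of_bool (v \<in> S))"

lemma support_char_vec [simp]: "support (char_vec S) = S"
  by (auto simp: support_def char_vec_def)

lemma char_vec_support [simp]: "char_vec (support x) = x"
  by (auto simp: support_def char_vec_def fun_eq_iff)

lemma support_add: "support (x + y) = sym_diff (support x) (support y)"
proof -
  have "x v + y v \<noteq> 0 \<longleftrightarrow> (x v \<noteq> 0) \<noteq> (y v \<noteq> 0)" for v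
    by (cases "x v"; cases "y v") auto
  then show ?thesis by (auto simp: support_def)
qed

lemma of_nat_bit_eq_0_iff: "(of_nat k :: bit) = 0 \<longleftrightarrow> even k"
  by (induction k) auto

lemma sum_char_vec:
  assumes "finite V" "S \<subseteq> V"
  shows "(\<Sum>w \<in> V. a w * char_vec S w) = (\<Sum>w \<in> S. a w)"
proof -
  have "(\<Sum>w \<in> V. a w * char_vec S w) = (\<Sum>w \<in> S. a w * char_vec S w)"
    using assms by (intro sum.mono_neutral_right) (auto simp: char_vec_def)
  also have "\<dots> = (\<Sum>w \<in> S. a w)"
    by (intro sum.cong) (simp_all only: char_vec_def of_bool_eq mult_1_right)
  finally show ?thesis .
qed

text \<open>The left-hand sum is the dot product of \<open>x\<close> with the characteristic vector of \<open>T\<close>, so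
  orthogonality of vectors becomes even intersection of their supports.\<close>

lemma sum_eq_0_iff_even:
  assumes "finite T"
  shows "(\<Sum>w \<in> T. (x w :: bit)) = 0 \<longleftrightarrow> even (card (support x \<inter> T))"
proof -
  have "(\<Sum>w \<in> T. x w) = (\<Sum>w \<in> T. if w \<in> support x then 1 else 0)"
    by (intro sum.cong) (auto simp: support_def)
  also have "\<dots> = of_nat (card (support x \<inter> T))"
    using assms by (simp add: sum.If_cases Int_commute)
  finally show ?thesis by (simp add: of_nat_bit_eq_0_iff)
qed

lemma mem_nullspace_iff:
  assumes "finite V"
  shows "S \<in> nullspace V A \<longleftrightarrow> S \<subseteq> V \<and> (\<forall>v \<in> V. (\<Sum>w \<in> S. A v w) = 0)"
proof
  assume "S \<in> nullspace V A"
  then obtain x where x: "S = support x" "support x \<subseteq> V" "\<forall>v \<in> V. (\<Sum>w \<in> V. A v w * x w) = 0"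
    by (auto simp: nullspace_def)
  then show "S \<subseteq> V \<and> (\<forall>v \<in> V. (\<Sum>w \<in> S. A v w) = 0)"
    using sum_char_vec[OF assms, of S "A v" for v] by simp
next
  assume "S \<subseteq> V \<and> (\<forall>v \<in> V. (\<Sum>w \<in> S. A v w) = 0)"
  then show "S \<in> nullspace V A"
    unfolding nullspace_def using sum_char_vec[OF assms, of S]
    by (intro image_eqI[of _ _ "char_vec S"]) auto
qed

lemma mem_nullspace_iff_column_sum:
  assumes "finite V"
  shows "S \<in> nullspace V A \<longleftrightarrow> S \<subseteq> V \<and> (\<Sum>w \<in> S. column V A w) = 0"
proof -
  have "(\<Sum>w \<in> S. column V A w) v = (\<Sum>w \<in> S. column V A w v)" for v
    by (induction S rule: infinite_finite_induct) auto
  moreover have "(\<Sum>w \<in> S. column V A w v) = (if v \<in> V then \<Sum>w \<in> S. A v w else 0)" for v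
    by (simp add: column_def)
  ultimately show ?thesis
    unfolding mem_nullspace_iff[OF assms] by (auto simp: fun_eq_iff)
qed

lemma nullspace_eq_orthogonal_rows:
  assumes "finite V"
  shows "nullspace V A = orthogonal V ((\<lambda>v. support (A v)) ` V)"
proof (rule set_eqI)
  fix S
  have "(\<Sum>w \<in> S. A v w) = 0 \<longleftrightarrow> even (card (support (A v) \<inter> S))" if "S \<subseteq> V" for v
    using that assms by (intro sum_eq_0_iff_even) (rule finite_subset)
  then show "S \<in> nullspace V A \<longleftrightarrow> S \<in> orthogonal V ((\<lambda>v. support (A v)) ` V)"
    unfolding mem_nullspace_iff[OF assms] orthogonal_def by auto
qed

lemma power_subspace_column_space: "power_subspace V (column_space V A)"
proof -
  have "support x \<subseteq> V" if "x \<in> gf2.span (column V A ` V)" for x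
    using that
  proof (induction rule: gf2.span_induct_alt)
    case base
    then show ?case by (simp add: support_def)
  next
    case (step c x y)
    then show ?case by (auto simp: support_def column_def bit_scale_def)
  qed
  moreover have "{} \<in> column_space V A"
    unfolding column_space_def
    by (rule image_eqI[of _ _ 0]) (auto simp: support_def gf2.span_zero)
  moreover have "sym_diff X Y \<in> column_space V A"
    if "X \<in> column_space V A" "Y \<in> column_space V A" for X Y
    using that unfolding column_space_def
    by (auto simp: support_add[symmetric] intro!: imageI gf2.span_add)
  ultimately show ?thesis by (auto simp: power_subspace_def column_space_def)
qed

text \<open>The equations that define the nullspace say that \<open>T\<close> is orthogonal to every row. By
  symmetry the rows are the columns, and orthogonality passes from the columns to their span.\<close>

lemma nullspace_eq_orthogonal_column_space:
  assumes fin: "finite V" and sym: "\<And>v w. v \<in> V \<Longrightarrow> w \<in> V \<Longrightarrow> A v w = A w v"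
  shows "nullspace V A = orthogonal V (column_space V A)"
proof -
  have "T \<in> nullspace V A \<longleftrightarrow> (\<forall>X \<in> column_space V A. even (card (X \<inter> T)))" if T: "T \<subseteq> V" for T
  proof -
    have finT: "finite T" using T fin by (rule finite_subset)
    have col: "(\<Sum>w \<in> T. A v w) = (\<Sum>w \<in> T. column V A v w)" if "v \<in> V" for v
      using T that sym by (intro sum.cong) (auto simp: column_def)
    have "(\<forall>v \<in> V. (\<Sum>w \<in> T. column V A v w) = 0) \<longleftrightarrow>
      (\<forall>x \<in> gf2.span (column V A ` V). (\<Sum>w \<in> T. x w) = 0)"
    proof
      assume z: "\<forall>v \<in> V. (\<Sum>w \<in> T. column V A v w) = 0"
      have "(\<Sum>w \<in> T. x w) = 0" if "x \<in> gf2.span (column V A ` V)" for x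
        using that
      proof (induction rule: gf2.span_induct_alt)
        case base
        then show ?case by simp
      next
        case (step c x y)
        have "(\<Sum>w \<in> T. (bit_scale c x + y) w) = c * (\<Sum>w \<in> T. x w) + (\<Sum>w \<in> T. y w)"
          by (simp only: plus_fun_apply bit_scale_def sum.distrib sum_distrib_left)
        then show ?case using z step by auto
      qed
      then show "\<forall>x \<in> gf2.span (column V A ` V). (\<Sum>w \<in> T. x w) = 0" by blast
    qed (use gf2.span_base in blast)
    then show ?thesis
      using T col
      by (simp add: mem_nullspace_iff[OF fin] column_space_def sum_eq_0_iff_even[OF finT])
  qed
  moreover have "nullspace V A \<subseteq> Pow V" by (auto simp: nullspace_def)
  ultimately show ?thesis by (auto simp: orthogonal_def)
qed

text \<open>Over the two-element field a linear combination of a family is the sum of a subfamily, so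
  dependencies are sets of indices. Two equal columns add up to zero, which is why the
  right-hand side accounts for injectivity as well.\<close>

lemma column_family_independent_iff:
  assumes fin: "finite V" and S: "S \<subseteq> V"
  shows "inj_on (column V A) S \<and> gf2.independent (column V A ` S) \<longleftrightarrow>
    (\<forall>T \<in> nullspace V A. T \<subseteq> S \<longrightarrow> T = {})"
proof
  let ?c = "column V A"
  assume ind: "inj_on ?c S \<and> gf2.independent (?c ` S)"
  have False if T: "T \<in> nullspace V A" "T \<subseteq> S" "T \<noteq> {}" for T
  proof -
    have "finite T" using T S fin by (meson finite_subset)
    have "inj_on ?c T" using ind T inj_on_subset by blast
    then have "(\<Sum>x \<in> ?c ` T. bit_scale 1 x) = (\<Sum>w \<in> T. ?c w)"
      by (simp add: sum.reindex)
    also have "\<dots> = 0" using T by (simp add: mem_nullspace_iff_column_sum[OF fin])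
    finally have "gf2.dependent (?c ` S)"
      unfolding gf2.dependent_explicit using T \<open>finite T\<close>
      by (intro exI[of _ "?c ` T"] exI[of _ "\<lambda>_. 1"]) auto
    then show False using ind by blast
  qed
  then show "\<forall>T \<in> nullspace V A. T \<subseteq> S \<longrightarrow> T = {}" by blast
next
  let ?c = "column V A"
  assume none: "\<forall>T \<in> nullspace V A. T \<subseteq> S \<longrightarrow> T = {}"
  have inj: "inj_on ?c S"
  proof (rule inj_onI, rule ccontr)
    fix a b assume ab: "a \<in> S" "b \<in> S" "?c a = ?c b" "a \<noteq> b"
    have "?c a + ?c b = 0" using ab by (simp add: fun_eq_iff)
    then have mem: "{a, b} \<in> nullspace V A"
      using ab S by (auto simp: mem_nullspace_iff_column_sum[OF fin])
    have "{a, b} \<subseteq> S" using ab by simp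
    then have "{a, b} = {}" by (rule none[rule_format, OF mem])
    then show False by simp
  qed
  moreover have "gf2.independent (?c ` S)"
  proof
    assume "gf2.dependent (?c ` S)"
    then obtain K u where K: "finite K" "K \<subseteq> ?c ` S" "(\<Sum>x \<in> K. bit_scale (u x) x) = 0"
      and nz: "\<exists>x \<in> K. u x \<noteq> 0" by (auto simp: gf2.dependent_explicit)
    \<comment> \<open>The coefficients are \<open>0\<close> or \<open>1\<close>, so only the vectors with coefficient \<open>1\<close> matter.\<close>
    let ?K = "{x \<in> K. u x \<noteq> 0}"
    have "?K \<subseteq> ?c ` S" using K by blast
    then obtain T where T: "T \<subseteq> S" "?K = ?c ` T" by (rule subset_imageE)
    have "(\<Sum>w \<in> T. ?c w) = (\<Sum>x \<in> ?K. x)"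
      using T inj by (simp add: sum.reindex inj_on_subset)
    also have "\<dots> = (\<Sum>x \<in> ?K. bit_scale (u x) x)"
      by (intro sum.cong) (auto simp: bit_scale_def)
    also have "\<dots> = (\<Sum>x \<in> K. bit_scale (u x) x)"
      using K by (intro sum.mono_neutral_left) (auto simp: bit_scale_def fun_eq_iff)
    finally have "T \<in> nullspace V A"
      using K T S by (simp add: mem_nullspace_iff_column_sum[OF fin])
    then show False using none T nz by blast
  qed
  ultimately show "inj_on ?c S \<and> gf2.independent (?c ` S)" by blast
qed

lemma cycle_space_column_matroid:
  assumes fin: "finite V"
  shows "cycle_space (column_matroid V A) (nullspace V A)"
proof -
  have "power_subspace V (nullspace V A)"
    by (simp only: nullspace_eq_orthogonal_rows[OF fin] power_subspace_orthogonal[OF fin])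
  moreover have "indep (column_matroid V A) S \<longleftrightarrow>
      S \<subseteq> V \<and> (\<forall>T \<in> nullspace V A. T \<subseteq> S \<longrightarrow> T = {})" for S
    using column_family_independent_iff[OF fin, of S A] by (auto simp: column_matroid_def)
  ultimately show ?thesis by (simp add: cycle_space_def column_matroid_def)
qed

section \<open>Adjacency matroids\<close>

lemma adjacency_matrix_sym: "adjacency_matrix G v w = adjacency_matrix G w v"
  by (auto simp: adjacency_matrix_def adjacent_def insert_commute)

theorem theorem5:
  fixes G :: "('v, 'e) multigraph" and G' :: "('w, 'd) multigraph"
    and f :: "'v \<Rightarrow> 'w" and n :: nat
  assumes "finite_multigraph G" and "finite_multigraph G'"
    and "card (verts G) = n" and "card (verts G') = n"
    and "bij_betw f (verts G) (verts G')"
  shows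
    "((matroid_isomorphism f (adjacency_matroid G) (adjacency_matroid G')
         \<longleftrightarrow> power_map f ` column_space (verts G) (adjacency_matrix G)
           = column_space (verts G') (adjacency_matrix G')) \<and>
      (power_map f ` column_space (verts G) (adjacency_matrix G)
           = column_space (verts G') (adjacency_matrix G')
         \<longleftrightarrow> power_map f ` nullspace (verts G) (adjacency_matrix G)
           = nullspace (verts G') (adjacency_matrix G'))) \<and>
     ((matroid_isomorphism f (adjacency_matroid G) (dual_matroid (adjacency_matroid G'))
         \<longleftrightarrow> power_map f ` column_space (verts G) (adjacency_matrix G)
           = nullspace (verts G') (adjacency_matrix G')) \<and>
      (power_map f ` column_space (verts G) (adjacency_matrix G)
           = nullspace (verts G') (adjacency_matrix G')
         \<longleftrightarrow> power_map f ` nullspace (verts G) (adjacency_matrix G)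
           = column_space (verts G') (adjacency_matrix G')))"
proof -
  let ?V = "verts G" and ?V' = "verts G'"
  let ?C = "column_space ?V (adjacency_matrix G)" and ?N = "nullspace ?V (adjacency_matrix G)"
  let ?C' = "column_space ?V' (adjacency_matrix G')" and ?N' = "nullspace ?V' (adjacency_matrix G')"
  let ?M = "adjacency_matroid G" and ?M' = "adjacency_matroid G'"
  note f = assms(5)
  have fin: "finite ?V" and fin': "finite ?V'"
    using assms(1,2) by (simp_all add: finite_multigraph.finite_verts)
  have ground [simp]: "ground ?M = ?V" "ground ?M' = ?V'" "ground (dual_matroid ?M') = ?V'"
    by (simp_all add: adjacency_matroid_def column_matroid_def dual_matroid_def)
  have C: "power_subspace ?V ?C" and C': "power_subspace ?V' ?C'"
    by (rule power_subspace_column_space)+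
  have N: "?N = orthogonal ?V ?C" and N': "?N' = orthogonal ?V' ?C'"
    using nullspace_eq_orthogonal_column_space
        [where A = "adjacency_matrix G", OF fin adjacency_matrix_sym]
      nullspace_eq_orthogonal_column_space
        [where A = "adjacency_matrix G'", OF fin' adjacency_matrix_sym]
    by simp_all
  have CN': "?C' = orthogonal ?V' ?N'" using N' orthogonal_orthogonal[OF fin' C'] by simp
  have spN': "power_subspace ?V' ?N'" using N' power_subspace_orthogonal[OF fin'] by simp
  have cyc: "cycle_space ?M ?N" "cycle_space ?M' ?N'"
    unfolding adjacency_matroid_def
    by (rule cycle_space_column_matroid[OF fin] cycle_space_column_matroid[OF fin'])+
  have dual: "cycle_space (dual_matroid ?M') ?C'"
    using cycle_space_dual[OF _ cyc(2)] fin' CN' by simp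
  have pm: "power_map f = (`) f" by (simp add: fun_eq_iff power_map_def)
  have e1: "matroid_isomorphism f ?M ?M' \<longleftrightarrow> (`) f ` ?N = ?N'"
    using isomorphism_iff_cycle_space[OF _ _ cyc] fin f by simp
  have e2: "(`) f ` ?N = ?N' \<longleftrightarrow> (`) f ` ?C = ?C'"
    unfolding N N' by (rule image_orthogonal_eq_iff[OF fin f C C'])
  have e3: "matroid_isomorphism f ?M (dual_matroid ?M') \<longleftrightarrow> (`) f ` ?N = ?C'"
    using isomorphism_iff_cycle_space[OF _ _ cyc(1) dual] fin f by simp
  have e4: "(`) f ` ?N = ?C' \<longleftrightarrow> (`) f ` ?C = ?N'"
    using image_orthogonal_eq_iff[OF fin f C spN'] N CN' by simp
  show ?thesis unfolding pm e1 e2 e3 e4 by simp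
qed

end
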